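(* Let $\pi\in C$, let $(m_n)_{n\ge1}$ be a sequence of positive integers, and let $c_n=2n(n+m_n)/m_n$. Consider the convergence $$c_nL_{Y|X}(\theta,\pi)\to L(\theta,\pi)\quad(n\to\infty)\ \text{ uniformly in compact subsets of }\Theta,\qquad( * )$$ where $L(\theta,\pi)=D(\theta,\pi)-D(\theta,\pi^J)$. (a) Suppose that R1 holds. Then $( * )$ holds whenever $\liminf_{n\to\infty}m_n/n>0$. (b) Suppose that R2 holds. Then $( * )$ holds whenever $m_n\to\infty$. (c) Suppose that R3 holds. Then $( * )$ holds for every sequence $(m_n)$ of positive integers. Here R1, R2, R3 are the three remainder conditions (defined in the context), each understood to hold for both $\pi$ and $\pi^J$.
   Context: Let $\Theta\subset\mathbb{R}^p$ be open, $p\ge1$; $X_1,X_2,\dots$ are independent observations from a density $f(\cdot|\theta)$, $\theta\in\Theta$, with respect to a $\sigma$-finite measure $\mu$. $X=(X_1,\dots,X_n)$ and $Y=(X_{n+1},\dots,X_{n+m_n})$, with densities $p(x|\theta)$ and $p(x,y|\theta)=p(x|\theta)p(y|\theta)$. A prior $\pi$ is a measure on $\Theta$, possibly improper; $p^\pi(x)=\int p(x|\theta)\,d\pi(\theta)$ and $p^\pi(y|x)$ is the posterior predictive density of $Y$ given $X=x$. $\Pi$ is the class of priors with $p^\pi(X)<\infty$ almost surely under every $\theta\in\Theta$. $d_X(\theta,\pi)=\int\log\{p(x|\theta)/p^\pi(x)\}p(x|\theta)\,d\mu(x)$. $\Pi_\infty$ is the class of $\pi\in\Pi$ such that, for all $n$,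 $d_X(\theta,\pi)<\infty$ for all $\theta\in\Theta$. $C\subset\Pi_\infty$ is the class of priors in $\Pi_\infty$ possessing densities (also denoted $\pi$) with continuous second-order derivatives throughout $\Theta$. $i(\theta)$ is the Fisher information matrix per observation; Jeffreys' prior is $\pi^J(\theta)=|i(\theta)|^{1/2}$, assumed to belong to $C$; $p^J$ denotes predictive densities under $\pi^J$. The posterior predictive loss is $$L_{Y|X}(\theta,\pi)=\iint\log\{p^J(y|x)/p^\pi(y|x)\}\,p(x,y|\theta)\,d\mu(x)\,d\mu(y).$$ For $\pi\in C$ define $h_n(\theta,\pi)$ by $$d_X(\theta,\pi)=\frac p2\log\Big(\frac n{2\pi e}\Big)+\log\Big\{\frac{|i(\theta)|^{1/2}}{\pi(\theta)}\Big\}-h_n(\theta,\pi)$$ (in $2\pi e$, $\pi$ is the number $3.14159\ldots$). Suppose that $$h_n(\theta,\pi)=\frac{D(\theta,\pi)}{2n}+r_n(\theta,\pi),$$ with $D(\theta,\pi)$ continuous in $\theta$ and not depending on $n$. The remainder conditions on $r_n(\theta,\pi)$ are: R1: $r_n(\theta,\pi)=o(n^{-1})$ uniformly in compacts of $\Theta$; R2: $r_n(\theta,\pi)=O(n^{-2})$ uniformly in compacts of $\Theta$; R3: $r_n(\theta,\pi)=E(\theta,\pi)n^{-2}+o(n^{-2})$ uniformly in compacts of $\Theta$, where $E(\theta,\pi)$ is continuous in $\theta$. *)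

theory Defs
  imports "HOL-Analysis.Analysis"
begin

section \<open>Extended logarithms and integrals\<close>

text \<open>
  The relative entropies may be infinite, and the predictive density of an improper prior may
  vanish or be infinite, so logarithms of ratios are formed in the extended reals, with
  \<open>log 0 = -\<infinity>\<close> and \<open>log \<infinity> = \<infinity>\<close>.  By the library's conventions \<open>\<plusminus>\<infinity> * 0 = 0\<close>, so an
  integrand \<open>log (p / q) * p\<close> is \<open>0\<close> where \<open>p = 0\<close> and is \<open>\<infinity>\<close> where \<open>p > 0 = q\<close>.
\<close>

definition elog :: "ennreal \<Rightarrow> ereal" where
  "elog x = (if x = 0 then - \<infinity> else if x = top then \<infinity> else ereal (ln (enn2real x)))"

text \<open>
  Positive part minus negative part.  In \<^typ>\<open>ereal\<close>, \<open>\<infinity> - a = \<infinity>\<close> for every \<open>a\<close>; hence the value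
  is \<open>< \<infinity>\<close> iff the positive part has finite integral, and is finite iff the integrand is
  integrable.  An undefined integral \<open>\<infinity> - \<infinity>\<close> is never counted as finite.
\<close>

definition ext_integral :: "'a measure \<Rightarrow> ('a \<Rightarrow> ereal) \<Rightarrow> ereal" where
  "ext_integral M g =
     enn2ereal (\<integral>\<^sup>+ x. e2ennreal (g x) \<partial>M) - enn2ereal (\<integral>\<^sup>+ x. e2ennreal (- g x) \<partial>M)"


section \<open>The statistical model\<close>

text \<open>\<open>f x \<theta>\<close> stands for \<open>f(x|\<theta>)\<close>; its values for \<open>\<theta> \<notin> \<Theta>\<close> are irrelevant.\<close>

definition statistical_model ::
  "(real ^ 'p) set \<Rightarrow> 'x measure \<Rightarrow> ('x \<Rightarrow> real ^ 'p \<Rightarrow> real) \<Rightarrow> bool" where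
  "statistical_model \<Theta> \<mu> f \<longleftrightarrow>
     open \<Theta> \<and> sigma_finite_measure \<mu> \<and>
     (\<lambda>(x, \<theta>). f x \<theta>) \<in> borel_measurable (\<mu> \<Otimes>\<^sub>M restrict_space borel \<Theta>) \<and>
     (\<forall>\<theta>\<in>\<Theta>. (\<forall>x\<in>space \<mu>. 0 \<le> f x \<theta>) \<and> (\<integral>\<^sup>+ x. ennreal (f x \<theta>) \<partial>\<mu>) = 1)"

definition sample_measure :: "'x measure \<Rightarrow> nat \<Rightarrow> (nat \<Rightarrow> 'x) measure" where
  "sample_measure \<mu> n = PiM {..<n} (\<lambda>_. \<mu>)"

text \<open>
  \<open>lik f n x \<theta>\<close> is \<open>p(x|\<theta>)\<close> for a sample \<open>x\<close> of size \<open>n\<close>.  The future sample \<open>Y\<close> of size \<open>m\<close> is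
  indexed by \<open>{..<m}\<close> as well (instead of \<open>n+1, \<dots>, n+m\<close>), with density \<open>lik f m y \<theta>\<close>.
\<close>

definition lik :: "('x \<Rightarrow> real ^ 'p \<Rightarrow> real) \<Rightarrow> nat \<Rightarrow> (nat \<Rightarrow> 'x) \<Rightarrow> real ^ 'p \<Rightarrow> real" where
  "lik f n x \<theta> = (\<Prod>i<n. f (x i) \<theta>)"


section \<open>Priors and predictive densities\<close>

definition marginal ::
  "('x \<Rightarrow> real ^ 'p \<Rightarrow> real) \<Rightarrow> nat \<Rightarrow> (real ^ 'p) measure \<Rightarrow> (nat \<Rightarrow> 'x) \<Rightarrow> ennreal" where
  "marginal f n \<pi> x = (\<integral>\<^sup>+ \<theta>. ennreal (lik f n x \<theta>) \<partial>\<pi>)"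

definition posterior ::
  "('x \<Rightarrow> real ^ 'p \<Rightarrow> real) \<Rightarrow> nat \<Rightarrow> (real ^ 'p) measure \<Rightarrow> (nat \<Rightarrow> 'x) \<Rightarrow> (real ^ 'p) measure"
  where
  "posterior f n \<pi> x = density \<pi> (\<lambda>\<theta>. ennreal (lik f n x \<theta>) / marginal f n \<pi> x)"

text \<open>\<open>predictive f n m \<pi> x y\<close> is \<open>p\<^sup>\<pi>(y|x)\<close> for \<open>x\<close> of size \<open>n\<close> and \<open>y\<close> of size \<open>m\<close>.\<close>

definition predictive ::
  "('x \<Rightarrow> real ^ 'p \<Rightarrow> real) \<Rightarrow> nat \<Rightarrow> nat \<Rightarrow> (real ^ 'p) measure \<Rightarrow>
     (nat \<Rightarrow> 'x) \<Rightarrow> (nat \<Rightarrow> 'x) \<Rightarrow> ennreal" where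
  "predictive f n m \<pi> x y = (\<integral>\<^sup>+ \<theta>. ennreal (lik f m y \<theta>) \<partial>posterior f n \<pi> x)"

definition d_X ::
  "'x measure \<Rightarrow> ('x \<Rightarrow> real ^ 'p \<Rightarrow> real) \<Rightarrow> nat \<Rightarrow> real ^ 'p \<Rightarrow> (real ^ 'p) measure \<Rightarrow> ereal" where
  "d_X \<mu> f n \<theta> \<pi> =
     ext_integral (sample_measure \<mu> n)
       (\<lambda>x. elog (ennreal (lik f n x \<theta>) / marginal f n \<pi> x) * ereal (lik f n x \<theta>))"

text \<open>
  The sample size is at least \<open>1\<close> throughout: for \<open>n = 0\<close> the marginal would be the total mass of
  the prior.
\<close>

definition prior_class ::
  "(real ^ 'p) set \<Rightarrow> 'x measure \<Rightarrow> ('x \<Rightarrow> real ^ 'p \<Rightarrow> real) \<Rightarrow> (real ^ 'p) measure set" where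
  "prior_class \<Theta> \<mu> f =
     {\<pi>. sets \<pi> = sets (restrict_space borel \<Theta>) \<and>
         (\<forall>n\<ge>1. \<forall>\<theta>\<in>\<Theta>. AE x in density (sample_measure \<mu> n) (\<lambda>x. ennreal (lik f n x \<theta>)).
            marginal f n \<pi> x < \<infinity>)}"

definition prior_class_inf ::
  "(real ^ 'p) set \<Rightarrow> 'x measure \<Rightarrow> ('x \<Rightarrow> real ^ 'p \<Rightarrow> real) \<Rightarrow> (real ^ 'p) measure set" where
  "prior_class_inf \<Theta> \<mu> f =
     {\<pi> \<in> prior_class \<Theta> \<mu> f. \<forall>n\<ge>1. \<forall>\<theta>\<in>\<Theta>. d_X \<mu> f n \<theta> \<pi> < \<infinity>}"

definition twice_continuously_differentiable_on ::
  "(real ^ 'p) set \<Rightarrow> (real ^ 'p \<Rightarrow> real) \<Rightarrow> bool" where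
  "twice_continuously_differentiable_on S g \<longleftrightarrow>
     (\<exists>(G :: real ^ 'p \<Rightarrow> real ^ 'p) (H :: real ^ 'p \<Rightarrow> real ^ 'p ^ 'p).
        (\<forall>\<theta>\<in>S. (g has_derivative (\<lambda>h. G \<theta> \<bullet> h)) (at \<theta>)) \<and>
        (\<forall>\<theta>\<in>S. (G has_derivative (\<lambda>h. H \<theta> *v h)) (at \<theta>)) \<and>
        continuous_on S H)"

definition prior_of :: "(real ^ 'p) set \<Rightarrow> (real ^ 'p \<Rightarrow> real) \<Rightarrow> (real ^ 'p) measure" where
  "prior_of \<Theta> g = density (restrict_space lborel \<Theta>) (\<lambda>\<theta>. ennreal (g \<theta>))"

text \<open>
  The priors in the class \<open>C\<close> are represented by their densities with respect to Lebesgue measure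
  on \<open>\<Theta>\<close>; a continuous density is determined on the open set \<open>\<Theta>\<close> by the prior.
\<close>

definition smooth_priors ::
  "(real ^ 'p) set \<Rightarrow> 'x measure \<Rightarrow> ('x \<Rightarrow> real ^ 'p \<Rightarrow> real) \<Rightarrow> (real ^ 'p \<Rightarrow> real) set" where
  "smooth_priors \<Theta> \<mu> f =
     {g. (\<forall>\<theta>\<in>\<Theta>. 0 \<le> g \<theta>) \<and> twice_continuously_differentiable_on \<Theta> g \<and>
         prior_of \<Theta> g \<in> prior_class_inf \<Theta> \<mu> f}"


section \<open>Fisher information and Jeffreys' prior\<close>

definition score :: "('x \<Rightarrow> real ^ 'p \<Rightarrow> real) \<Rightarrow> 'x \<Rightarrow> real ^ 'p \<Rightarrow> real ^ 'p" where
  "score f x \<theta> = (\<chi> j. deriv (\<lambda>t. ln (f x (\<theta> + t *\<^sub>R axis j 1))) 0)"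

definition fisher_info ::
  "'x measure \<Rightarrow> ('x \<Rightarrow> real ^ 'p \<Rightarrow> real) \<Rightarrow> real ^ 'p \<Rightarrow> real ^ 'p ^ 'p" where
  "fisher_info \<mu> f \<theta> = (\<chi> j k. \<integral>x. score f x \<theta> $ j * score f x \<theta> $ k * f x \<theta> \<partial>\<mu>)"

definition jeffreys ::
  "'x measure \<Rightarrow> ('x \<Rightarrow> real ^ 'p \<Rightarrow> real) \<Rightarrow> real ^ 'p \<Rightarrow> real" where
  "jeffreys \<mu> f \<theta> = sqrt (det (fisher_info \<mu> f \<theta>))"


section \<open>The predictive loss and the expansion of the relative entropy\<close>

definition L_YX ::
  "(real ^ 'p) set \<Rightarrow> 'x measure \<Rightarrow> ('x \<Rightarrow> real ^ 'p \<Rightarrow> real) \<Rightarrow> nat \<Rightarrow> nat \<Rightarrow>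
     real ^ 'p \<Rightarrow> (real ^ 'p \<Rightarrow> real) \<Rightarrow> ereal" where
  "L_YX \<Theta> \<mu> f n m \<theta> \<pi> =
     ext_integral (sample_measure \<mu> n \<Otimes>\<^sub>M sample_measure \<mu> m)
       (\<lambda>(x, y). elog (predictive f n m (prior_of \<Theta> (jeffreys \<mu> f)) x y
                        / predictive f n m (prior_of \<Theta> \<pi>) x y)
                  * ereal (lik f n x \<theta> * lik f m y \<theta>))"

text \<open>
  The defining relation of \<open>h\<^sub>n\<close>, solved for \<open>h\<^sub>n\<close>.  Its value is infinite when \<open>\<pi> \<theta> = 0\<close>, when
  \<open>|i(\<theta>)| = 0\<close>, or when \<open>d_X\<close> is infinite; the expansion below, whose right-hand side is real,
  therefore excludes these cases.
\<close>

definition h_n ::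
  "(real ^ 'p) set \<Rightarrow> 'x measure \<Rightarrow> ('x \<Rightarrow> real ^ 'p \<Rightarrow> real) \<Rightarrow> nat \<Rightarrow>
     real ^ 'p \<Rightarrow> (real ^ 'p \<Rightarrow> real) \<Rightarrow> ereal" where
  "h_n \<Theta> \<mu> f n \<theta> \<pi> =
     ereal (real CARD('p) / 2 * ln (real n / (2 * pi * exp 1)))
     + elog (ennreal (sqrt (det (fisher_info \<mu> f \<theta>))) / ennreal (\<pi> \<theta>))
     - d_X \<mu> f n \<theta> (prior_of \<Theta> \<pi>)"

definition h_expansion ::
  "(real ^ 'p) set \<Rightarrow> 'x measure \<Rightarrow> ('x \<Rightarrow> real ^ 'p \<Rightarrow> real) \<Rightarrow>
     (real ^ 'p \<Rightarrow> (real ^ 'p \<Rightarrow> real) \<Rightarrow> real) \<Rightarrow>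
     (nat \<Rightarrow> real ^ 'p \<Rightarrow> (real ^ 'p \<Rightarrow> real) \<Rightarrow> real) \<Rightarrow> (real ^ 'p \<Rightarrow> real) \<Rightarrow> bool" where
  "h_expansion \<Theta> \<mu> f D r \<pi> \<longleftrightarrow>
     continuous_on \<Theta> (\<lambda>\<theta>. D \<theta> \<pi>) \<and>
     (\<forall>n\<ge>1. \<forall>\<theta>\<in>\<Theta>. h_n \<Theta> \<mu> f n \<theta> \<pi> = ereal (D \<theta> \<pi> / (2 * real n) + r n \<theta> \<pi>))"

definition R1 ::
  "(real ^ 'p) set \<Rightarrow> (nat \<Rightarrow> real ^ 'p \<Rightarrow> (real ^ 'p \<Rightarrow> real) \<Rightarrow> real) \<Rightarrow>
     (real ^ 'p \<Rightarrow> real) \<Rightarrow> bool" where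
  "R1 \<Theta> r \<pi> \<longleftrightarrow>
     (\<forall>K. compact K \<and> K \<subseteq> \<Theta> \<longrightarrow>
        uniform_limit K (\<lambda>n \<theta>. real n * r n \<theta> \<pi>) (\<lambda>_. 0) sequentially)"

definition R2 ::
  "(real ^ 'p) set \<Rightarrow> (nat \<Rightarrow> real ^ 'p \<Rightarrow> (real ^ 'p \<Rightarrow> real) \<Rightarrow> real) \<Rightarrow>
     (real ^ 'p \<Rightarrow> real) \<Rightarrow> bool" where
  "R2 \<Theta> r \<pi> \<longleftrightarrow>
     (\<forall>K. compact K \<and> K \<subseteq> \<Theta> \<longrightarrow>
        (\<exists>B. \<forall>\<^sub>F n in sequentially. \<forall>\<theta>\<in>K. \<bar>r n \<theta> \<pi>\<bar> \<le> B / (real n)\<^sup>2))"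

definition R3 ::
  "(real ^ 'p) set \<Rightarrow> (nat \<Rightarrow> real ^ 'p \<Rightarrow> (real ^ 'p \<Rightarrow> real) \<Rightarrow> real) \<Rightarrow>
     (real ^ 'p \<Rightarrow> real) \<Rightarrow> bool" where
  "R3 \<Theta> r \<pi> \<longleftrightarrow>
     (\<exists>E. continuous_on \<Theta> E \<and>
        (\<forall>K. compact K \<and> K \<subseteq> \<Theta> \<longrightarrow>
           uniform_limit K (\<lambda>n \<theta>. (real n)\<^sup>2 * (r n \<theta> \<pi> - E \<theta> / (real n)\<^sup>2)) (\<lambda>_. 0) sequentially))"

text \<open>
  Uniform convergence on compact subsets of \<open>\<Theta>\<close> of extended-real functions to a real function;
  it includes the assertion that, on each compact set, the functions are eventually finite.
\<close>

definition converges_on_compacts ::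
  "(real ^ 'p) set \<Rightarrow> (nat \<Rightarrow> real ^ 'p \<Rightarrow> ereal) \<Rightarrow> (real ^ 'p \<Rightarrow> real) \<Rightarrow> bool" where
  "converges_on_compacts \<Theta> F G \<longleftrightarrow>
     (\<forall>K. compact K \<and> K \<subseteq> \<Theta> \<longrightarrow>
        (\<forall>\<^sub>F n in sequentially. \<forall>\<theta>\<in>K. \<bar>F n \<theta>\<bar> \<noteq> \<infinity>) \<and>
        uniform_limit K (\<lambda>n \<theta>. real_of_ereal (F n \<theta>)) G sequentially)"

definition loss_convergence ::
  "(real ^ 'p) set \<Rightarrow> 'x measure \<Rightarrow> ('x \<Rightarrow> real ^ 'p \<Rightarrow> real) \<Rightarrow>
     (real ^ 'p \<Rightarrow> (real ^ 'p \<Rightarrow> real) \<Rightarrow> real) \<Rightarrow> (real ^ 'p \<Rightarrow> real) \<Rightarrow> (nat \<Rightarrow> nat) \<Rightarrow> bool" where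
  "loss_convergence \<Theta> \<mu> f D \<pi> m \<longleftrightarrow>
     converges_on_compacts \<Theta>
       (\<lambda>n \<theta>. ereal (2 * real n * real (n + m n) / real (m n)) * L_YX \<Theta> \<mu> f n (m n) \<theta> \<pi>)
       (\<lambda>\<theta>. D \<theta> \<pi> - D \<theta> (jeffreys \<mu> f))"

end

theory Submission
  imports Defs
begin

text \<open>
  By the chain rule for relative entropy, \<open>L\<^sub>Y\<^sub>|\<^sub>X(\<theta>,\<pi>)\<close> is the increment of \<open>d\<^sub>X(\<theta>,\<pi>)\<close> from sample size
  \<open>n\<close> to \<open>n + m\<close>, minus the same increment for Jeffreys' prior.  The logarithmic terms cancel, which leaves
  \<open>(h\<^sub>n - h\<^sub>n\<^sub>+\<^sub>m)(\<theta>,\<pi>) - (h\<^sub>n - h\<^sub>n\<^sub>+\<^sub>m)(\<theta>,\<pi>\<^sup>J)\<close>.  Since \<open>c\<^sub>n (1/(2n) - 1/(2(n+m))) = 1\<close>, the terms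
  \<open>D/(2n)\<close> contribute exactly the limit \<open>L\<close>, and it remains that
  \<open>c\<^sub>n (r\<^sub>n - r\<^sub>n\<^sub>+\<^sub>m)\<close> tends to \<open>0\<close> uniformly on compacts.
\<close>

section \<open>Extended integrals\<close>

lemma borel_measurable_elog [measurable]: "elog \<in> borel_measurable borel"
  unfolding elog_def by measurable

lemma elog_finite_iff: "\<bar>elog x\<bar> \<noteq> \<infinity> \<longleftrightarrow> x \<noteq> 0 \<and> x \<noteq> top"
  by (auto simp: elog_def)

lemma elog_ennreal: "0 < x \<Longrightarrow> elog (ennreal x) = ereal (ln x)"
  by (simp add: elog_def)

lemma e2ennreal_ereal: "e2ennreal (ereal x) = ennreal x"
  by (simp add: ennreal.abs_eq e2ennreal_def ennreal_def)

text \<open>Positive and negative part of \<open>g\<close> agree almost everywhere with those of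
  \<open>h\<close>, and both have finite integral. Together with the converse below, this allows
  passing between extended integrals and Bochner integrals.\<close>

lemma ext_integral_ereal:
  assumes h: "integrable M h" and g: "AE x in M. g x = ereal (h x)"
  shows "ext_integral M g = ereal (\<integral>x. h x \<partial>M)"
proof -
  have pos: "(\<integral>\<^sup>+ x. e2ennreal (g x) \<partial>M) = (\<integral>\<^sup>+ x. ennreal (h x) \<partial>M)"
    using g by (intro nn_integral_cong_AE) (auto simp: e2ennreal_ereal)
  have neg: "(\<integral>\<^sup>+ x. e2ennreal (- g x) \<partial>M) = (\<integral>\<^sup>+ x. ennreal (- h x) \<partial>M)"
    using g by (intro nn_integral_cong_AE) (auto simp: e2ennreal_ereal)
  obtain a where a: "(\<integral>\<^sup>+ x. ennreal (h x) \<partial>M) = ennreal a" "0 \<le> a"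
    using h by (auto simp: real_integrable_def intro: ennreal_cases[of "\<integral>\<^sup>+ x. ennreal (h x) \<partial>M"])
  obtain b where b: "(\<integral>\<^sup>+ x. ennreal (- h x) \<partial>M) = ennreal b" "0 \<le> b"
    using h by (auto simp: real_integrable_def intro: ennreal_cases[of "\<integral>\<^sup>+ x. ennreal (- h x) \<partial>M"])
  show ?thesis
    using h unfolding ext_integral_def pos neg
    by (simp add: real_lebesgue_integral_def a b enn2ereal_ennreal)
qed

lemma ext_integral_finiteD:
  assumes g [measurable]: "g \<in> borel_measurable M" and fin: "\<bar>ext_integral M g\<bar> \<noteq> \<infinity>"
  shows "AE x in M. g x = ereal (real_of_ereal (g x))"
    and "integrable M (\<lambda>x. real_of_ereal (g x))"
proof -
  \<comment> \<open>If either part is infinite, so is the difference: in \<open>ereal\<close> even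
    \<infinity> - \<infinity> is \<infinity>.\<close>
  have *: "(\<integral>\<^sup>+ x. e2ennreal (g x) \<partial>M) \<noteq> \<infinity>" "(\<integral>\<^sup>+ x. e2ennreal (- g x) \<partial>M) \<noteq> \<infinity>"
    using fin unfolding ext_integral_def
    by (cases "\<integral>\<^sup>+ x. e2ennreal (g x) \<partial>M"; cases "\<integral>\<^sup>+ x. e2ennreal (- g x) \<partial>M";
        auto simp: enn2ereal_ennreal top_ennreal.rep_eq)+
  \<comment> \<open>A nonnegative function with finite integral is finite almost everywhere; using
    both signs excludes both infinite values of \<open>g\<close>.\<close>
  have "AE x in M. e2ennreal (g x) \<noteq> \<infinity>" "AE x in M. e2ennreal (- g x) \<noteq> \<infinity>"
    using * by (auto intro!: nn_integral_PInf_AE simp del: infinity_ennreal_def)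
  then show ae: "AE x in M. g x = ereal (real_of_ereal (g x))"
  proof eventually_elim
    case (elim x)
    then show ?case by (cases "g x") auto
  qed
  have "(\<integral>\<^sup>+ x. ennreal (real_of_ereal (g x)) \<partial>M) = (\<integral>\<^sup>+ x. e2ennreal (g x) \<partial>M)"
    "(\<integral>\<^sup>+ x. ennreal (- real_of_ereal (g x)) \<partial>M) = (\<integral>\<^sup>+ x. e2ennreal (- g x) \<partial>M)"
    using ae by (auto intro!: nn_integral_cong_AE elim!: eventually_mono)
      (metis e2ennreal_ereal uminus_ereal.simps(1))+
  then show "integrable M (\<lambda>x. real_of_ereal (g x))"
    using * by (simp add: real_integrable_def)
qed

section \<open>Samples and marginal densities\<close>

text \<open>If \<open>N\<close> is null in \<open>A\<close>, then \<open>N \<times> space B\<close>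
  is null in the product, since 0 * \<infinity> = 0 for measures.\<close>

lemma AE_pair_measureI_fst:
  assumes B: "sigma_finite_measure B" and P: "AE x in A. P x"
  shows "AE z in A \<Otimes>\<^sub>M B. P (fst z)"
proof -
  interpret sigma_finite_measure B by fact
  obtain N where N: "N \<in> null_sets A" "{x \<in> space A. \<not> P x} \<subseteq> N"
    using AE_E[OF P] by (auto simp: null_sets_def)
  have "N \<times> space B \<in> null_sets (A \<Otimes>\<^sub>M B)"
    using N(1) by (auto simp: null_sets_def emeasure_pair_measure_Times)
  moreover have "{z \<in> space (A \<Otimes>\<^sub>M B). \<not> P (fst z)} \<subseteq> N \<times> space B"
    using N(2) by (auto simp: space_pair_measure)
  ultimately show ?thesis by (rule AE_I')
qed

text \<open>The second sample, indexed by \<open>{..<m}\<close>, is shifted to \<open>{n..<n + m}\<close>.\<close>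

definition append_sample :: "nat \<Rightarrow> nat \<Rightarrow> (nat \<Rightarrow> 'x) \<times> (nat \<Rightarrow> 'x) \<Rightarrow> nat \<Rightarrow> 'x" where
  "append_sample n m = (\<lambda>(x, y). \<lambda>i\<in>{..<n + m}. if i < n then x i else y (i - n))"

text \<open>This identity carries the independence of the two samples: the index set splits into the
  first \<open>n\<close> indices and a shifted copy of \<open>{..<m}\<close>.\<close>

lemma lik_append_sample:
  "lik f (n + m) (append_sample n m (x, y)) \<theta> = lik f n x \<theta> * lik f m y \<theta>"
proof -
  have "i \<in> (\<lambda>i. i + n) ` {..<m}" if "i < n + m" "\<not> i < n" for i
    using that by (intro image_eqI[of _ _ "i - n"]) auto
  then have "{..<n + m} = {..<n} \<union> (\<lambda>i. i + n) ` {..<m}"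
    by auto
  then have "lik f (n + m) (append_sample n m (x, y)) \<theta> =
      (\<Prod>i\<in>{..<n} \<union> (\<lambda>i. i + n) ` {..<m}. f (append_sample n m (x, y) i) \<theta>)"
    by (simp add: lik_def)
  also have "\<dots> = (\<Prod>i<n. f (append_sample n m (x, y) i) \<theta>) *
      (\<Prod>i\<in>(\<lambda>i. i + n) ` {..<m}. f (append_sample n m (x, y) i) \<theta>)"
    by (rule prod.union_disjoint) auto
  also have "\<dots> = lik f n x \<theta> * lik f m y \<theta>"
    by (subst prod.reindex) (auto simp: lik_def append_sample_def intro!: arg_cong2[where f="(*)"] prod.cong)
  finally show ?thesis .
qed

lemma measurable_append_sample [measurable]:
  "append_sample n m \<in> sample_measure \<mu> n \<Otimes>\<^sub>M sample_measure \<mu> m \<rightarrow>\<^sub>M sample_measure \<mu> (n + m)"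
  unfolding append_sample_def sample_measure_def split_beta'
proof (rule measurable_restrict)
  fix i assume i: "i \<in> {..<n + m}"
  show "(\<lambda>z. if i < n then fst z i else snd z (i - n))
      \<in> PiM {..<n} (\<lambda>_. \<mu>) \<Otimes>\<^sub>M PiM {..<m} (\<lambda>_. \<mu>) \<rightarrow>\<^sub>M \<mu>"
  proof (cases "i < n")
    case True
    then show ?thesis by simp
  next
    case False
    with i have "i - n \<in> {..<m}" by auto
    with False show ?thesis by simp
  qed
qed

section \<open>Sample spaces and likelihoods of the model\<close>

locale model =
  fixes \<Theta> :: "(real ^ 'p) set" and \<mu> :: "'x measure" and f :: "'x \<Rightarrow> real ^ 'p \<Rightarrow> real"
  assumes model: "statistical_model \<Theta> \<mu> f"
begin

abbreviation "S \<equiv> sample_measure \<mu>"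

abbreviation "B \<equiv> restrict_space (borel :: (real ^ 'p) measure) \<Theta>"

lemma open_parameters: "open \<Theta>"
  using model by (simp add: statistical_model_def)

sublocale product_sigma_finite "\<lambda>_::nat. \<mu>"
  using model by (simp add: statistical_model_def product_sigma_finite_def)

lemma sigma_finite_sample: "sigma_finite_measure (S n)"
  unfolding sample_measure_def by (rule sigma_finite) simp

lemma pair_sigma_finite_sample: "pair_sigma_finite (S n) (S m)"
  by (simp add: pair_sigma_finite_def sigma_finite_sample)

text \<open>A finite product of \<sigma>-finite measures is determined by its values on boxes, and
  the preimage of a box is a product of two boxes. Integrals and null sets can thus be moved between
  a sample of size \<open>n + m\<close> and a pair of samples.\<close>

lemma distr_append_sample: "distr (S n \<Otimes>\<^sub>M S m) (S (n + m)) (append_sample n m) = S (n + m)"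
  unfolding sample_measure_def[of \<mu> "n + m"]
proof (rule PiM_eqI)
  fix A :: "nat \<Rightarrow> 'x set"
  assume A: "\<And>i. i \<in> {..<n + m} \<Longrightarrow> A i \<in> sets \<mu>"
  interpret Sm: sigma_finite_measure "S m" by (rule sigma_finite_sample)
  have eq: "append_sample n m -` Pi\<^sub>E {..<n + m} A \<inter> space (S n \<Otimes>\<^sub>M S m) =
      Pi\<^sub>E {..<n} A \<times> Pi\<^sub>E {..<m} (\<lambda>i. A (i + n))" (is "?L = ?R")
  proof (intro set_eqI iffI)
    fix z assume z: "z \<in> ?L"
    then have *: "append_sample n m z i \<in> A i" if "i < n + m" for i
      using that by (auto simp: PiE_iff)
    have "fst z i \<in> A i" if "i < n" for i
      using *[of i] that by (auto simp: append_sample_def split_beta)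
    moreover have "snd z i \<in> A (i + n)" if "i < m" for i
      using *[of "i + n"] that by (auto simp: append_sample_def split_beta)
    ultimately show "z \<in> ?R"
      using z by (auto simp: space_pair_measure sample_measure_def space_PiM PiE_iff)
  next
    fix z assume z: "z \<in> ?R"
    have app: "append_sample n m z i \<in> A i" if "i < n + m" for i
    proof (cases "i < n")
      case True
      with z show ?thesis by (auto simp: append_sample_def PiE_iff)
    next
      case False
      have "snd z j \<in> A (j + n)" if "j < m" for j
        using z that by (auto simp: PiE_iff)
      from this[of "i - n"] False that have "snd z (i - n) \<in> A i"
        by simp
      with False that show ?thesis by (auto simp: append_sample_def split_beta)
    qed
    have ext: "append_sample n m z \<in> extensional {..<n + m}"
      by (simp add: append_sample_def split_beta)
    \<comment> \<open>Membership of \<open>z\<close> in the product space is not part of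
      \<open>?R\<close>; it follows because every side of the box is measurable, hence a subset of
      \<open>space \<mu>\<close>.\<close>
    have A': "a \<in> space \<mu>" if "i < n + m" "a \<in> A i" for i a
      using A[of i] that sets.sets_into_space by auto
    have "fst z i \<in> space \<mu>" if "i < n" for i
      using z that by (intro A'[of i]) (auto simp: PiE_iff)
    moreover have "snd z i \<in> space \<mu>" if "i < m" for i
      using z that by (intro A'[of "i + n"]) (auto simp: PiE_iff)
    ultimately have "z \<in> space (S n \<Otimes>\<^sub>M S m)"
      using z by (auto simp: space_pair_measure sample_measure_def space_PiM PiE_iff)
    with app ext show "z \<in> ?L" by (simp add: PiE_iff)
  qed
  have "Pi\<^sub>E {..<n + m} A \<in> sets (S (n + m))"
    unfolding sample_measure_def using A by (intro sets_PiM_I_finite) auto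
  then have "emeasure (distr (S n \<Otimes>\<^sub>M S m) (S (n + m)) (append_sample n m)) (Pi\<^sub>E {..<n + m} A) =
      emeasure (S n \<Otimes>\<^sub>M S m) (Pi\<^sub>E {..<n} A \<times> Pi\<^sub>E {..<m} (\<lambda>i. A (i + n)))"
    by (simp add: emeasure_distr eq)
  also have "\<dots> = emeasure (S n) (Pi\<^sub>E {..<n} A) * emeasure (S m) (Pi\<^sub>E {..<m} (\<lambda>i. A (i + n)))"
    using A by (intro Sm.emeasure_pair_measure_Times)
      (auto simp: sample_measure_def intro!: sets_PiM_I_finite)
  also have "\<dots> = (\<Prod>i<n. emeasure \<mu> (A i)) * (\<Prod>i<m. emeasure \<mu> (A (i + n)))"
    using A emeasure_PiM[of "{..<n}" A] emeasure_PiM[of "{..<m}" "\<lambda>i. A (i + n)"]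
    by (simp add: sample_measure_def)
  also have "\<dots> = (\<Prod>i<n + m. emeasure \<mu> (A i))"
    using prod.atLeastLessThan_concat[of 0 n "n + m" "\<lambda>i. emeasure \<mu> (A i)"]
      prod.shift_bounds_nat_ivl[of "\<lambda>i. emeasure \<mu> (A i)" 0 n m]
    by (simp add: atLeast0LessThan add.commute)
  finally show "emeasure (distr (S n \<Otimes>\<^sub>M S m) (PiM {..<n + m} (\<lambda>_. \<mu>)) (append_sample n m)) (Pi\<^sub>E {..<n + m} A) =
      (\<Prod>i<n + m. emeasure \<mu> (A i))"
    by (simp add: sample_measure_def)
qed (auto simp: sample_measure_def)

lemma measurable_density: "\<theta> \<in> \<Theta> \<Longrightarrow> (\<lambda>x. f x \<theta>) \<in> borel_measurable \<mu>"
proof -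
  assume "\<theta> \<in> \<Theta>"
  then have "(\<lambda>x. (x, \<theta>)) \<in> \<mu> \<rightarrow>\<^sub>M \<mu> \<Otimes>\<^sub>M B"
    by (intro measurable_Pair) (auto simp: space_restrict_space)
  from measurable_compose[OF this, of "\<lambda>(x, \<theta>). f x \<theta>" borel] show ?thesis
    using model by (simp add: statistical_model_def)
qed

lemma measurable_lik_pair: "(\<lambda>(x, \<theta>). lik f n x \<theta>) \<in> borel_measurable (S n \<Otimes>\<^sub>M B)"
  unfolding lik_def split_beta'
proof (rule borel_measurable_prod)
  fix i assume "i \<in> {..<n}"
  then have "(\<lambda>z. (fst z i, snd z)) \<in> S n \<Otimes>\<^sub>M B \<rightarrow>\<^sub>M \<mu> \<Otimes>\<^sub>M B"
    unfolding sample_measure_def by measurable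
  from measurable_compose[OF this, of "\<lambda>(x, \<theta>). f x \<theta>" borel]
  show "(\<lambda>z. f (fst z i) (snd z)) \<in> borel_measurable (S n \<Otimes>\<^sub>M B)"
    using model by (simp add: statistical_model_def)
qed

lemma measurable_lik: "\<theta> \<in> \<Theta> \<Longrightarrow> (\<lambda>x. lik f n x \<theta>) \<in> borel_measurable (S n)"
  using measurable_compose[OF measurable_Pair1' measurable_lik_pair]
    measurable_compose[OF measurable_Pair2' measurable_lik_pair, of \<theta> n]
  by (simp add: space_restrict_space)

lemma measurable_lik_parameter: "x \<in> space (S n) \<Longrightarrow> (\<lambda>\<theta>. lik f n x \<theta>) \<in> borel_measurable B"
  using measurable_compose[OF measurable_Pair1' measurable_lik_pair] by simp

lemma lik_nonneg: "\<theta> \<in> \<Theta> \<Longrightarrow> x \<in> space (S n) \<Longrightarrow> 0 \<le> lik f n x \<theta>"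
  using model unfolding lik_def statistical_model_def sample_measure_def
  by (intro prod_nonneg) (auto simp: space_PiM PiE_iff)

lemma nn_integral_lik:
  assumes "\<theta> \<in> \<Theta>"
  shows "(\<integral>\<^sup>+ x. ennreal (lik f n x \<theta>) \<partial>S n) = 1"
proof -
  have "(\<integral>\<^sup>+ x. ennreal (lik f n x \<theta>) \<partial>S n) = (\<integral>\<^sup>+ x. (\<Prod>i<n. ennreal (f (x i) \<theta>)) \<partial>S n)"
    using model assms unfolding lik_def statistical_model_def sample_measure_def
    by (intro nn_integral_cong prod_ennreal[symmetric]) (auto simp: space_PiM PiE_iff)
  also have "\<dots> = (\<Prod>i<n. \<integral>\<^sup>+ x. ennreal (f x \<theta>) \<partial>\<mu>)"
    unfolding sample_measure_def using measurable_density[OF assms]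
    by (intro product_nn_integral_prod) auto
  also have "\<dots> = 1"
    using model assms by (simp add: statistical_model_def)
  finally show ?thesis .
qed

lemma integrable_lik: "\<theta> \<in> \<Theta> \<Longrightarrow> integrable (S n) (\<lambda>x. lik f n x \<theta>)"
  using nn_integral_lik[of \<theta> n] measurable_lik[of \<theta> n] lik_nonneg
  by (intro integrableI_nonneg) auto

lemma integral_lik: "\<theta> \<in> \<Theta> \<Longrightarrow> (\<integral>x. lik f n x \<theta> \<partial>S n) = 1"
  using nn_integral_lik[of \<theta> n] measurable_lik[of \<theta> n] lik_nonneg
  by (subst integral_eq_nn_integral) auto

end

section \<open>The predictive loss as a difference of relative entropies\<close>

text \<open>The real-valued integrand of \<open>d_X\<close>, made for Bochner integration.
  \<open>real_of_ereal\<close> sends infinite logarithms to 0; when \<open>d_X\<close> is finite,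
  this changes the integrand only on a null set.\<close>

definition entropy_integrand ::
  "('x \<Rightarrow> real ^ 'p \<Rightarrow> real) \<Rightarrow> nat \<Rightarrow> (real ^ 'p) measure \<Rightarrow> real ^ 'p \<Rightarrow> (nat \<Rightarrow> 'x) \<Rightarrow> real" where
  "entropy_integrand f n Q \<theta> x =
     real_of_ereal (elog (ennreal (lik f n x \<theta>) / marginal f n Q x)) * lik f n x \<theta>"

lemma entropy_integrand_eq:
  assumes "0 < lik f n x \<theta>" "marginal f n Q x = ennreal a" "0 < a"
  shows "entropy_integrand f n Q \<theta> x = (ln (lik f n x \<theta>) - ln a) * lik f n x \<theta>"
  using assms by (simp add: entropy_integrand_def divide_ennreal elog_ennreal ln_div)

text \<open>An improper prior may have infinite mass, but its density is real-valued, and a finite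
  density over a \<sigma>-finite measure is again \<sigma>-finite. This is what makes
  \<open>marginal\<close> measurable in the sample.\<close>

lemma (in model) sigma_finite_prior_of:
  assumes "continuous_on \<Theta> g"
  shows "sigma_finite_measure (prior_of \<Theta> g)"
proof -
  have \<Theta>: "\<Theta> \<in> sets borel" using open_parameters by simp
  interpret R: sigma_finite_measure "restrict_space lborel \<Theta>"
    using \<Theta> by (intro sigma_finite_measure_restrict_space sigma_finite_lborel) auto
  have "(\<lambda>\<theta>. ennreal (g \<theta>)) \<in> borel_measurable (restrict_space lborel \<Theta>)"
    using borel_measurable_continuous_on_restrict[OF assms]
    by (simp add: measurable_restrict_space_iff cong: measurable_cong_sets)
  then show ?thesis
    unfolding prior_of_def by (subst R.sigma_finite_iff_density_finite) auto
qed

section \<open>Marginal and predictive densities under a fixed prior\<close>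

locale model_prior = model \<Theta> \<mu> f + Q: sigma_finite_measure Q
  for \<Theta> :: "(real ^ 'p) set" and \<mu> :: "'x measure" and f :: "'x \<Rightarrow> real ^ 'p \<Rightarrow> real"
    and Q :: "(real ^ 'p) measure" +
  assumes sets_prior: "sets Q = sets (restrict_space borel \<Theta>)"
begin

lemma space_prior: "space Q = \<Theta>"
  using sets_eq_imp_space_eq[OF sets_prior] by (simp add: space_restrict_space)

lemma measurable_marginal [measurable]: "marginal f n Q \<in> borel_measurable (S n)"
proof -
  have "(\<lambda>(x, \<theta>). lik f n x \<theta>) \<in> borel_measurable (S n \<Otimes>\<^sub>M Q)"
    using measurable_lik_pair by (simp add: measurable_def sets_prior space_prior space_pair_measure space_restrict_space cong: sets_pair_measure_cong)
  then have "(\<lambda>(x, \<theta>). ennreal (lik f n x \<theta>)) \<in> borel_measurable (S n \<Otimes>\<^sub>M Q)"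
    by (simp add: split_beta')
  then show ?thesis
    unfolding marginal_def by (rule Q.borel_measurable_nn_integral)
qed

text \<open>The normalising factor of the posterior does not depend on the parameter, and the
  product of likelihoods is the likelihood of the joined sample. Division by a constant leaves an
  \<open>ennreal\<close> integral even if the constant is 0 or \<infinity>, so the identity holds
  pointwise.\<close>

lemma predictive_eq:
  assumes x: "x \<in> space (S n)" and y: "y \<in> space (S m)"
  shows "predictive f n m Q x y =
    marginal f (n + m) Q (append_sample n m (x, y)) / marginal f n Q x"
proof -
  have [measurable]: "(\<lambda>\<theta>. lik f n x \<theta>) \<in> borel_measurable Q" "(\<lambda>\<theta>. lik f m y \<theta>) \<in> borel_measurable Q"
    using measurable_lik_parameter[OF x] measurable_lik_parameter[OF y]
    by (simp_all cong: measurable_cong_sets add: sets_prior)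
  have "predictive f n m Q x y =
      (\<integral>\<^sup>+ \<theta>. ennreal (lik f n x \<theta>) / marginal f n Q x * ennreal (lik f m y \<theta>) \<partial>Q)"
    unfolding predictive_def posterior_def by (subst nn_integral_density) auto
  also have "\<dots> = (\<integral>\<^sup>+ \<theta>. ennreal (lik f (n + m) (append_sample n m (x, y)) \<theta>) / marginal f n Q x \<partial>Q)"
    by (intro nn_integral_cong)
      (simp add: lik_append_sample ennreal_mult lik_nonneg x y space_prior ennreal_times_divide mult.commute)
  also have "\<dots> = marginal f (n + m) Q (append_sample n m (x, y)) / marginal f n Q x"
    unfolding marginal_def by (intro nn_integral_divide) (simp add: lik_append_sample)
  finally show ?thesis .
qed

context
  fixes n \<theta>
  assumes \<theta>: "\<theta> \<in> \<Theta>" and fin: "\<bar>d_X \<mu> f n \<theta> Q\<bar> \<noteq> \<infinity>"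
begin

lemma entropy_integrand_measurable:
  "(\<lambda>x. elog (ennreal (lik f n x \<theta>) / marginal f n Q x) * ereal (lik f n x \<theta>)) \<in> borel_measurable (S n)"
  using measurable_lik[OF \<theta>, of n] by measurable

lemma integrable_entropy_integrand: "integrable (S n) (entropy_integrand f n Q \<theta>)"
  using ext_integral_finiteD(2)[OF entropy_integrand_measurable] fin
  by (simp add: d_X_def entropy_integrand_def[abs_def])

lemma d_X_eq_integral: "d_X \<mu> f n \<theta> Q = ereal (\<integral>x. entropy_integrand f n Q \<theta> x \<partial>S n)"
  unfolding d_X_def
  using ext_integral_finiteD(1)[OF entropy_integrand_measurable] fin
  by (intro ext_integral_ereal integrable_entropy_integrand) (simp add: d_X_def entropy_integrand_def)

text \<open>Where the likelihood is positive, a marginal equal to 0 or \<infinity> makes the ratio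
  \<infinity> or 0 and its logarithm infinite. A finite \<open>d_X\<close> allows this only on a
  null set.\<close>

lemma AE_marginal_pos_finite:
  "AE x in S n. lik f n x \<theta> \<noteq> 0 \<longrightarrow> (\<exists>a>0. marginal f n Q x = ennreal a)"
proof -
  have "AE x in S n. elog (ennreal (lik f n x \<theta>) / marginal f n Q x) * ereal (lik f n x \<theta>) =
      ereal (real_of_ereal (elog (ennreal (lik f n x \<theta>) / marginal f n Q x) * ereal (lik f n x \<theta>)))"
    using ext_integral_finiteD(1)[OF entropy_integrand_measurable] fin by (simp add: d_X_def)
  then show ?thesis
  proof (rule AE_mp, intro AE_I2 impI)
    fix x assume x: "x \<in> space (S n)" and lik: "lik f n x \<theta> \<noteq> 0"
      and eq: "elog (ennreal (lik f n x \<theta>) / marginal f n Q x) * ereal (lik f n x \<theta>) =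
      ereal (real_of_ereal (elog (ennreal (lik f n x \<theta>) / marginal f n Q x) * ereal (lik f n x \<theta>)))"
    have p: "0 < lik f n x \<theta>" using lik lik_nonneg[OF \<theta> x] by simp
    have "\<bar>elog (ennreal (lik f n x \<theta>) / marginal f n Q x)\<bar> \<noteq> \<infinity>"
      using eq p by (cases "elog (ennreal (lik f n x \<theta>) / marginal f n Q x)") auto
    then have nz: "ennreal (lik f n x \<theta>) / marginal f n Q x \<noteq> 0"
      "ennreal (lik f n x \<theta>) / marginal f n Q x \<noteq> top"
      by (auto simp: elog_finite_iff)
    show "\<exists>a>0. marginal f n Q x = ennreal a"
    proof (cases "marginal f n Q x")
      case (real a)
      have "a \<noteq> 0" using nz(2) p real by (auto simp: ennreal_divide_zero)
      with real show ?thesis by (auto intro!: exI[of _ a])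
    next
      case top
      with nz(1) show ?thesis by simp
    qed
  qed
qed

end

end

text \<open>
  Where \<open>p(x,y|\<theta>) > 0\<close>, almost every marginal occurring in the loss is positive and finite, because
  the relative entropies are finite; the chain rule \<open>p(y|x) = p(x,y) / p(x)\<close> then splits the logarithm.
\<close>

lemma (in model) L_YX_eq:
  assumes Q: "continuous_on \<Theta> g" and J: "continuous_on \<Theta> (jeffreys \<mu> f)" and \<theta>: "\<theta> \<in> \<Theta>"
    and Qfin: "\<bar>d_X \<mu> f n \<theta> (prior_of \<Theta> g)\<bar> \<noteq> \<infinity>" "\<bar>d_X \<mu> f (n + m) \<theta> (prior_of \<Theta> g)\<bar> \<noteq> \<infinity>"
    and Jfin: "\<bar>d_X \<mu> f n \<theta> (prior_of \<Theta> (jeffreys \<mu> f))\<bar> \<noteq> \<infinity>"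
      "\<bar>d_X \<mu> f (n + m) \<theta> (prior_of \<Theta> (jeffreys \<mu> f))\<bar> \<noteq> \<infinity>"
  shows "L_YX \<Theta> \<mu> f n m \<theta> g =
    (d_X \<mu> f (n + m) \<theta> (prior_of \<Theta> g) - d_X \<mu> f n \<theta> (prior_of \<Theta> g)) -
    (d_X \<mu> f (n + m) \<theta> (prior_of \<Theta> (jeffreys \<mu> f)) - d_X \<mu> f n \<theta> (prior_of \<Theta> (jeffreys \<mu> f)))"
proof -
  define P where "P = prior_of \<Theta> g"
  define R where "R = prior_of \<Theta> (jeffreys \<mu> f)"
  interpret P: model_prior \<Theta> \<mu> f P
    using sigma_finite_prior_of[OF Q]
    by (intro model_prior.intro model_prior_axioms.intro) (auto simp: P_def prior_of_def sets_restrict_space model_axioms)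
  interpret R: model_prior \<Theta> \<mu> f R
    using sigma_finite_prior_of[OF J]
    by (intro model_prior.intro model_prior_axioms.intro) (auto simp: R_def prior_of_def sets_restrict_space model_axioms)
  interpret pair: pair_sigma_finite "S n" "S m" by (rule pair_sigma_finite_sample)
  let ?N = "S n \<Otimes>\<^sub>M S m"
  let ?T = "append_sample n m"
  \<comment> \<open>Both entropies are lifted to pairs of samples: the one for size \<open>n\<close>
    by a factor \<open>lik f m y \<theta>\<close>, whose integral is 1, the one for size
    \<open>n + m\<close> by pulling back along \<open>append_sample\<close>.\<close>
  let ?F = "\<lambda>Q z. entropy_integrand f n Q \<theta> (fst z) * lik f m (snd z) \<theta>"
  let ?G = "\<lambda>Q z. entropy_integrand f (n + m) Q \<theta> (?T z)"
  have F: "integrable ?N (?F Q)" "(\<integral>z. ?F Q z \<partial>?N) = (\<integral>x. entropy_integrand f n Q \<theta> x \<partial>S n)"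
    if int: "integrable (S n) (entropy_integrand f n Q \<theta>)" for Q
  proof -
    have [measurable]: "entropy_integrand f n Q \<theta> \<in> borel_measurable (S n)"
      using int by simp
    note measurable_lik[OF \<theta>, measurable]
    have "(\<lambda>z. ?F Q z) \<in> borel_measurable ?N" by measurable
    then show i: "integrable ?N (?F Q)"
      using int integrable_lik[OF \<theta>, of m]
      by (intro pair.Fubini_integrable) (auto simp: abs_mult)
    show "(\<integral>z. ?F Q z \<partial>?N) = (\<integral>x. entropy_integrand f n Q \<theta> x \<partial>S n)"
      using pair.integral_fst'[OF i] by (simp add: integral_lik[OF \<theta>])
  qed
  have G: "integrable ?N (?G Q)" "(\<integral>z. ?G Q z \<partial>?N) = (\<integral>x. entropy_integrand f (n + m) Q \<theta> x \<partial>S (n + m))"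
    if int: "integrable (S (n + m)) (entropy_integrand f (n + m) Q \<theta>)" for Q
  proof -
    have *: "integrable (distr ?N (S (n + m)) ?T) (entropy_integrand f (n + m) Q \<theta>)"
      using int by (simp add: distr_append_sample)
    show "integrable ?N (?G Q)"
      using integrable_distr[OF measurable_append_sample *] .
    show "(\<integral>z. ?G Q z \<partial>?N) = (\<integral>x. entropy_integrand f (n + m) Q \<theta> x \<partial>S (n + m))"
      using integral_distr[OF measurable_append_sample[where \<mu>=\<mu> and n=n and m=m],
        of "entropy_integrand f (n + m) Q \<theta>"] int
      by (simp add: distr_append_sample)
  qed
  have AE_pair: "AE z in ?N. (lik f n (fst z) \<theta> \<noteq> 0 \<longrightarrow> (\<exists>a>0. marginal f n Q (fst z) = ennreal a)) \<and>
      (lik f (n + m) (?T z) \<theta> \<noteq> 0 \<longrightarrow> (\<exists>a>0. marginal f (n + m) Q (?T z) = ennreal a))"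
    if "AE x in S n. lik f n x \<theta> \<noteq> 0 \<longrightarrow> (\<exists>a>0. marginal f n Q x = ennreal a)"
      "AE x in S (n + m). lik f (n + m) x \<theta> \<noteq> 0 \<longrightarrow> (\<exists>a>0. marginal f (n + m) Q x = ennreal a)"
    for Q
  proof -
    \<comment> \<open>As \<open>append_sample\<close> preserves measure, null sets for size
      \<open>n + m\<close> pull back to null sets of pairs.\<close>
    have "AE z in distr ?N (S (n + m)) ?T.
        lik f (n + m) z \<theta> \<noteq> 0 \<longrightarrow> (\<exists>a>0. marginal f (n + m) Q z = ennreal a)"
      using that(2) by (simp only: distr_append_sample)
    from AE_distrD[OF measurable_append_sample this]
      AE_pair_measureI_fst[OF sigma_finite_sample that(1), of m]
    show ?thesis by eventually_elim simp
  qed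
  note fins = Qfin[folded P_def] Jfin[folded R_def]
  note intP = P.integrable_entropy_integrand[OF \<theta> fins(1)] P.integrable_entropy_integrand[OF \<theta> fins(2)]
  note intR = R.integrable_entropy_integrand[OF \<theta> fins(3)] R.integrable_entropy_integrand[OF \<theta> fins(4)]
  \<comment> \<open>In each inner difference the likelihoods leave the logarithm of
    \<open>lik f m y \<theta>\<close>, which is the same for both priors and cancels.\<close>
  let ?h = "\<lambda>z. (?G P z - ?F P z) - (?G R z - ?F R z)"
  have "L_YX \<Theta> \<mu> f n m \<theta> g = ereal (\<integral>z. ?h z \<partial>?N)"
    unfolding L_YX_def P_def[symmetric] R_def[symmetric]
  proof (rule ext_integral_ereal)
    show "integrable ?N ?h"
      by (intro Bochner_Integration.integrable_diff F(1) G(1) intP intR)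
    have "AE z in ?N. (lik f n (fst z) \<theta> \<noteq> 0 \<longrightarrow> (\<exists>a>0. marginal f n P (fst z) = ennreal a)) \<and>
      (lik f (n + m) (?T z) \<theta> \<noteq> 0 \<longrightarrow> (\<exists>a>0. marginal f (n + m) P (?T z) = ennreal a))"
      using fins by (intro AE_pair P.AE_marginal_pos_finite \<theta>)
    moreover have "AE z in ?N. (lik f n (fst z) \<theta> \<noteq> 0 \<longrightarrow> (\<exists>a>0. marginal f n R (fst z) = ennreal a)) \<and>
      (lik f (n + m) (?T z) \<theta> \<noteq> 0 \<longrightarrow> (\<exists>a>0. marginal f (n + m) R (?T z) = ennreal a))"
      using fins by (intro AE_pair R.AE_marginal_pos_finite \<theta>)
    ultimately show "AE z in ?N. (case z of (x, y) \<Rightarrow>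
        elog (predictive f n m R x y / predictive f n m P x y) * ereal (lik f n x \<theta> * lik f m y \<theta>)) = ereal (?h z)"
      using AE_space
    proof eventually_elim
      case (elim z)
      obtain x y where z: "z = (x, y)" by (cases z)
      have x: "x \<in> space (S n)" and y: "y \<in> space (S m)"
        using elim(3) by (auto simp: z space_pair_measure)
      show ?case
      proof (cases "lik f n x \<theta> * lik f m y \<theta> = 0")
        \<comment> \<open>Both sides vanish here, because an infinite logarithm times 0 is 0 in
          \<open>ereal\<close>.\<close>
        case True
        then show ?thesis
          by (auto simp: z entropy_integrand_def lik_append_sample simp flip: zero_ereal_def)
      next
        case False
        then have pos: "0 < lik f n x \<theta>" "0 < lik f m y \<theta>"
          using lik_nonneg[OF \<theta> x] lik_nonneg[OF \<theta> y] by auto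
        then have pos': "0 < lik f (n + m) (?T (x, y)) \<theta>"
          by (simp add: lik_append_sample)
        from elim(1) pos pos' obtain a b where
          P: "0 < a" "0 < b" "marginal f n P x = ennreal a" "marginal f (n + m) P (?T (x, y)) = ennreal b"
          by (auto simp: z)
        from elim(2) pos pos' obtain c d where
          R: "0 < c" "0 < d" "marginal f n R x = ennreal c" "marginal f (n + m) R (?T (x, y)) = ennreal d"
          by (auto simp: z)
        have "predictive f n m R x y / predictive f n m P x y = ennreal ((d / c) / (b / a))"
          using P R by (simp add: P.predictive_eq R.predictive_eq x y divide_ennreal)
        moreover have "0 < (d / c) / (b / a)"
          using P R by simp
        ultimately have lhs: "elog (predictive f n m R x y / predictive f n m P x y) =
            ereal ((ln d - ln c) - (ln b - ln a))"
          using P R by (simp only: elog_ennreal) (simp add: ln_div ln_mult)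
        show ?thesis
          unfolding z split fst_conv snd_conv lhs times_ereal.simps lik_append_sample
            entropy_integrand_eq[OF pos(1) P(3,1)] entropy_integrand_eq[OF pos' P(4,2)]
            entropy_integrand_eq[OF pos(1) R(3,1)] entropy_integrand_eq[OF pos' R(4,2)]
          by (simp add: algebra_simps)
      qed
    qed
  qed
  also have "(\<integral>z. ?h z \<partial>?N) =
      ((\<integral>x. entropy_integrand f (n + m) P \<theta> x \<partial>S (n + m)) - (\<integral>x. entropy_integrand f n P \<theta> x \<partial>S n)) -
      ((\<integral>x. entropy_integrand f (n + m) R \<theta> x \<partial>S (n + m)) - (\<integral>x. entropy_integrand f n R \<theta> x \<partial>S n))"
    by (simp only: Bochner_Integration.integral_diff Bochner_Integration.integrable_diff
        F[OF intP(1)] F[OF intR(1)] G[OF intP(2)] G[OF intR(2)])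
  also have "ereal \<dots> = (d_X \<mu> f (n + m) \<theta> P - d_X \<mu> f n \<theta> P) - (d_X \<mu> f (n + m) \<theta> R - d_X \<mu> f n \<theta> R)"
    by (simp only: P.d_X_eq_integral[OF \<theta> fins(1)] P.d_X_eq_integral[OF \<theta> fins(2)]
        R.d_X_eq_integral[OF \<theta> fins(3)] R.d_X_eq_integral[OF \<theta> fins(4)] ereal_minus)
  finally show ?thesis by (simp add: P_def R_def)
qed

section \<open>Remainder terms\<close>

lemma uniform_limit_mult_null_bounded:
  fixes f :: "nat \<Rightarrow> 'a \<Rightarrow> real"
  assumes a: "a \<longlonglongrightarrow> 0" and f: "\<forall>\<^sub>F n in sequentially. \<forall>x\<in>S. \<bar>f n x\<bar> \<le> C"
  shows "uniform_limit S (\<lambda>n x. a n * f n x) (\<lambda>_. 0) sequentially"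
proof (rule uniform_limitI)
  fix e :: real assume e: "0 < e"
  \<comment> \<open>The divisor \<open>\<bar>C\<bar> + 1\<close> is positive whatever the value of
    \<open>C\<close>.\<close>
  have "\<forall>\<^sub>F n in sequentially. dist (a n) 0 < e / (\<bar>C\<bar> + 1)"
    using e by (intro tendstoD[OF a]) auto
  with f show "\<forall>\<^sub>F n in sequentially. \<forall>x\<in>S. dist (a n * f n x) 0 < e"
  proof eventually_elim
    case (elim n)
    have "\<bar>a n * f n x\<bar> < e" if "x \<in> S" for x
    proof -
      have "\<bar>a n * f n x\<bar> \<le> \<bar>a n\<bar> * (\<bar>C\<bar> + 1)"
        using elim(1) that by (auto simp: abs_mult intro!: mult_left_mono)
      also have "\<dots> < e" using elim(2) by (simp add: pos_less_divide_eq)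
      finally show ?thesis .
    qed
    then show ?case by simp
  qed
qed

lemma uniform_limit_mult_bounded_null:
  fixes f :: "nat \<Rightarrow> 'a \<Rightarrow> real"
  assumes a: "\<forall>\<^sub>F n in sequentially. \<bar>a n\<bar> \<le> C"
    and f: "uniform_limit S f (\<lambda>_. 0) sequentially"
  shows "uniform_limit S (\<lambda>n x. a n * f n x) (\<lambda>_. 0) sequentially"
proof (rule uniform_limitI)
  fix e :: real assume e: "0 < e"
  have "\<forall>\<^sub>F n in sequentially. \<forall>x\<in>S. dist (f n x) 0 < e / (\<bar>C\<bar> + 1)"
    using e by (intro uniform_limitD[OF f]) auto
  with a show "\<forall>\<^sub>F n in sequentially. \<forall>x\<in>S. dist (a n * f n x) 0 < e"
  proof eventually_elim
    case (elim n)
    have "\<bar>a n * f n x\<bar> < e" if "x \<in> S" for x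
    proof -
      have "\<bar>a n * f n x\<bar> \<le> (\<bar>C\<bar> + 1) * \<bar>f n x\<bar>"
        using elim(1) by (auto simp: abs_mult intro!: mult_right_mono)
      also have "\<dots> < e" using elim(2) that by (simp add: pos_less_divide_eq mult.commute)
      finally show ?thesis .
    qed
    then show ?case by simp
  qed
qed

text \<open>Asymptotics in the sample size may therefore be read along \<open>n + m n\<close>, with
  no growth condition on \<open>m\<close>.\<close>

lemma filterlim_add_at_top_nat: "filterlim (\<lambda>n. n + m n) at_top sequentially" for m :: "nat \<Rightarrow> nat"
  by (rule filterlim_at_top_mono[OF filterlim_ident]) auto

text \<open>The contribution of a remainder to the loss multiplied by \<open>2n(n+m)/m\<close>. As
  \<open>\<rho>\<close> does not mention the prior, one estimate serves both \<open>\<pi>\<close>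
  and Jeffreys' prior.\<close>

definition scaled_remainder :: "(nat \<Rightarrow> nat) \<Rightarrow> (nat \<Rightarrow> 'a \<Rightarrow> real) \<Rightarrow> nat \<Rightarrow> 'a \<Rightarrow> real" where
  "scaled_remainder m \<rho> n x = 2 * real n * real (n + m n) / real (m n) * (\<rho> n x - \<rho> (n + m n) x)"

text \<open>With c = 2n(n+m)/m one has c/n = 2 + 2n/m and c/(n+m) = 2n/m. The condition on the lower
  limit bounds n/m, so bounded coefficients multiply terms that tend to 0 uniformly.\<close>

lemma scaled_remainder_null_R1:
  assumes m: "\<forall>n\<ge>1. 1 \<le> m n"
    and lim: "liminf (\<lambda>n. ereal (real (m n) / real n)) > 0"
    and \<rho>: "uniform_limit K (\<lambda>n x. real n * \<rho> n x) (\<lambda>_. 0) sequentially"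
  shows "uniform_limit K (scaled_remainder m \<rho>) (\<lambda>_. 0) sequentially"
proof -
  \<comment> \<open>Any real \<open>c\<close> strictly between 0 and the lower limit is eventually a
    lower bound of m/n.\<close>
  obtain c where c: "0 < ereal c" "ereal c < liminf (\<lambda>n. ereal (real (m n) / real n))"
    using ereal_dense2[OF lim] by blast
  have ev: "\<forall>\<^sub>F n in sequentially. real n / real (m n) \<le> 1 / c"
    using less_LiminfD[OF c(2)] eventually_ge_at_top[of 1]
  proof eventually_elim
    case (elim n)
    with m c show ?case by (auto simp: field_simps)
  qed
  have \<rho>': "uniform_limit K (\<lambda>n x. real (n + m n) * \<rho> (n + m n) x) (\<lambda>_. 0) sequentially"
    using filterlim_compose[OF \<rho> filterlim_add_at_top_nat] .
  have "uniform_limit K (\<lambda>n x. (2 + 2 * (real n / real (m n))) * (real n * \<rho> n x)) (\<lambda>_. 0) sequentially"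
    by (intro uniform_limit_mult_bounded_null[OF _ \<rho>, where C = "2 + 2 * (1 / c)"]
        eventually_mono[OF ev]) auto
  moreover have "uniform_limit K (\<lambda>n x. (2 * (real n / real (m n))) * (real (n + m n) * \<rho> (n + m n) x))
      (\<lambda>_. 0) sequentially"
    by (intro uniform_limit_mult_bounded_null[OF _ \<rho>', where C = "2 * (1 / c)"]
        eventually_mono[OF ev]) auto
  ultimately have "uniform_limit K (\<lambda>n x. (2 + 2 * (real n / real (m n))) * (real n * \<rho> n x) -
      (2 * (real n / real (m n))) * (real (n + m n) * \<rho> (n + m n) x)) (\<lambda>_. 0 - 0) sequentially"
    by (rule uniform_limit_minus)
  then show ?thesis
  proof (rule uniform_limit_cong[THEN iffD1, rotated -1])
    show "\<forall>\<^sub>F n in sequentially. \<forall>x\<in>K. (2 + 2 * (real n / real (m n))) * (real n * \<rho> n x) -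
      (2 * (real n / real (m n))) * (real (n + m n) * \<rho> (n + m n) x) = scaled_remainder m \<rho> n x"
      using eventually_ge_at_top[of 1]
    proof eventually_elim
      case (elim n)
      with m have "real (m n) \<noteq> 0" by fastforce
      then show ?case by (auto simp: scaled_remainder_def field_simps)
    qed
  qed auto
qed

text \<open>
  With \<open>c\<^sub>n = 2n(n+m)/m\<close>, the coefficients below are \<open>c\<^sub>n / n\<^sup>2\<close> and \<open>c\<^sub>n / (n+m)\<^sup>2\<close>: they are bounded for
  every \<open>m\<close>, and tend to \<open>0\<close> when \<open>m\<close> tends to infinity.
\<close>

lemma scaled_remainder_quadratic:
  assumes "1 \<le> n" "1 \<le> m n"
  shows "scaled_remainder m \<rho> n x =
    (2 / real n + 2 / real (m n)) * ((real n)\<^sup>2 * \<rho> n x) -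
    2 / real (m n) * (real n / real (n + m n)) * ((real (n + m n))\<^sup>2 * \<rho> (n + m n) x)"
proof -
  have "real n \<noteq> 0" "real (m n) \<noteq> 0" "real (n + m n) \<noteq> 0" using assms by auto
  then show ?thesis
    unfolding scaled_remainder_def of_nat_add
    by (simp add: divide_simps power2_eq_square) algebra
qed

text \<open>Here the remainders scaled by the squared sample size are only bounded, so convergence
  comes from the coefficients, which vanish as \<open>m\<close> tends to infinity.\<close>

lemma scaled_remainder_null_R2:
  assumes m: "\<forall>n\<ge>1. 1 \<le> m n" and lim: "filterlim m at_top sequentially"
    and \<rho>: "\<forall>\<^sub>F n in sequentially. \<forall>x\<in>K. \<bar>\<rho> n x\<bar> \<le> b / (real n)\<^sup>2"
  shows "uniform_limit K (scaled_remainder m \<rho>) (\<lambda>_. 0) sequentially"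
proof -
  have bd: "\<forall>\<^sub>F n in sequentially. \<forall>x\<in>K. \<bar>(real n)\<^sup>2 * \<rho> n x\<bar> \<le> b"
    using \<rho> eventually_ge_at_top[of 1]
    by eventually_elim (auto simp: abs_mult field_simps)
  have bd': "\<forall>\<^sub>F n in sequentially. \<forall>x\<in>K. \<bar>(real (n + m n))\<^sup>2 * \<rho> (n + m n) x\<bar> \<le> b"
    using filterlim_add_at_top_nat[of m] bd unfolding filterlim_iff by blast
  have m0: "(\<lambda>n. 2 / real (m n)) \<longlonglongrightarrow> 0"
    by (intro tendsto_divide_0[OF tendsto_const] filterlim_at_top_imp_at_infinity
        filterlim_compose[OF filterlim_real_sequentially lim])
  have n0: "(\<lambda>n. 2 / real n) \<longlonglongrightarrow> 0"
    by (intro tendsto_divide_0[OF tendsto_const] filterlim_at_top_imp_at_infinity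
        filterlim_real_sequentially)
  have "(\<lambda>n. 2 / real (m n) * (real n / real (n + m n))) \<longlonglongrightarrow> 0"
  proof (rule tendsto_0_le[OF m0, where K = 1])
    have "2 / real (m n) * (real n / real (n + m n)) \<le> 2 / real (m n)" for n
      by (intro mult_left_le) (auto simp: divide_le_eq_1)
    then show "\<forall>\<^sub>F n in sequentially. norm (2 / real (m n) * (real n / real (n + m n))) \<le> norm (2 / real (m n)) * 1"
      by (simp add: abs_mult)
  qed
  from uniform_limit_minus[OF uniform_limit_mult_null_bounded[OF tendsto_add[OF n0 m0, simplified] bd]
      uniform_limit_mult_null_bounded[OF this bd']]
  have "uniform_limit K (\<lambda>n x. (2 / real n + 2 / real (m n)) * ((real n)\<^sup>2 * \<rho> n x) -
    2 / real (m n) * (real n / real (n + m n)) * ((real (n + m n))\<^sup>2 * \<rho> (n + m n) x)) (\<lambda>_. 0 - 0) sequentially" .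
  then show ?thesis
    by (rule uniform_limit_cong[THEN iffD1, rotated -1])
      (use m in \<open>auto simp: scaled_remainder_quadratic intro!: eventually_mono[OF eventually_ge_at_top[of 1]]\<close>)
qed

text \<open>Split off \<open>E\<close>. What is left of the remainder is null after quadratic
  scaling, and its coefficients are at most 4 and 2. The \<open>E\<close> terms combine to (2/n +
  2/(n+m)) E, which tends to 0 for every \<open>m\<close> because the factor 1/m cancels in the
  difference.\<close>

lemma scaled_remainder_null_R3:
  assumes m: "\<forall>n\<ge>1. 1 \<le> m n"
    and E: "\<forall>x\<in>K. \<bar>E x\<bar> \<le> b"
    and \<rho>: "uniform_limit K (\<lambda>n x. (real n)\<^sup>2 * (\<rho> n x - E x / (real n)\<^sup>2)) (\<lambda>_. 0) sequentially"
  shows "uniform_limit K (scaled_remainder m \<rho>) (\<lambda>_. 0) sequentially"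
proof -
  let ?\<sigma> = "\<lambda>n x. \<rho> n x - E x / (real n)\<^sup>2"
  have \<rho>': "uniform_limit K (\<lambda>n x. (real (n + m n))\<^sup>2 * ?\<sigma> (n + m n) x) (\<lambda>_. 0) sequentially"
    using filterlim_compose[OF \<rho> filterlim_add_at_top_nat] .
  have n0: "(\<lambda>n. 4 / real n) \<longlonglongrightarrow> 0"
    by (intro tendsto_divide_0[OF tendsto_const] filterlim_at_top_imp_at_infinity
        filterlim_real_sequentially)
  have "uniform_limit K (\<lambda>n x. (2 / real n + 2 / real (m n)) * ((real n)\<^sup>2 * ?\<sigma> n x)) (\<lambda>_. 0) sequentially"
  proof (intro uniform_limit_mult_bounded_null[OF _ \<rho>, where C = 4] eventually_mono[OF eventually_ge_at_top[of 1]])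
    fix n :: nat assume n: "1 \<le> n"
    with m have "2 / real n \<le> 2" "2 / real (m n) \<le> 2" by (auto simp: divide_le_eq)
    then show "\<bar>2 / real n + 2 / real (m n)\<bar> \<le> 4" by simp
  qed
  moreover have "uniform_limit K (\<lambda>n x. 2 / real (m n) * (real n / real (n + m n)) *
      ((real (n + m n))\<^sup>2 * ?\<sigma> (n + m n) x)) (\<lambda>_. 0) sequentially"
  proof (intro uniform_limit_mult_bounded_null[OF _ \<rho>', where C = 2] eventually_mono[OF eventually_ge_at_top[of 1]])
    fix n :: nat assume n: "1 \<le> n"
    with m have "2 / real (m n) \<le> 2" "real n / real (n + m n) \<le> 1" by (auto simp: divide_le_eq)
    from mult_mono[OF this] show "\<bar>2 / real (m n) * (real n / real (n + m n))\<bar> \<le> 2" by simp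
  qed
  ultimately have *: "uniform_limit K (\<lambda>n x. (2 / real n + 2 / real (m n)) * ((real n)\<^sup>2 * ?\<sigma> n x) -
      2 / real (m n) * (real n / real (n + m n)) * ((real (n + m n))\<^sup>2 * ?\<sigma> (n + m n) x))
      (\<lambda>_. 0 - 0) sequentially"
    by (rule uniform_limit_minus)
  have "(\<lambda>n. 2 / real n + 2 / real (n + m n)) \<longlonglongrightarrow> 0"
  proof (rule tendsto_0_le[OF n0, where K = 1])
    show "\<forall>\<^sub>F n in sequentially. norm (2 / real n + 2 / real (n + m n)) \<le> norm (4 / real n) * 1"
      using eventually_ge_at_top[of 1]
    proof eventually_elim
      case (elim n)
      then have "2 / real (n + m n) \<le> 2 / real n" by (intro divide_left_mono) auto
      then show ?case by simp
    qed
  qed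
  from uniform_limit_mult_null_bounded[OF this, of K "\<lambda>_. E" b] E
  have "uniform_limit K (\<lambda>n x. (2 / real n + 2 / real (n + m n)) * E x) (\<lambda>_. 0) sequentially"
    by simp
  from uniform_limit_add[OF * this] show ?thesis
  proof (rule uniform_limit_cong[THEN iffD1, rotated -1])
    show "\<forall>\<^sub>F n in sequentially. \<forall>x\<in>K. (2 / real n + 2 / real (m n)) * ((real n)\<^sup>2 * ?\<sigma> n x) -
      2 / real (m n) * (real n / real (n + m n)) * ((real (n + m n))\<^sup>2 * ?\<sigma> (n + m n) x) +
      (2 / real n + 2 / real (n + m n)) * E x = scaled_remainder m \<rho> n x"
      using eventually_ge_at_top[of 1]
    proof eventually_elim
      case (elim n)
      with m have m1: "1 \<le> m n" by simp
      have "real n \<noteq> 0" "real (m n) \<noteq> 0" "real (n + m n) \<noteq> 0" using elim m1 by auto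
      then have "(2 / real n + 2 / real (m n)) * ((real n)\<^sup>2 * (E x / (real n)\<^sup>2)) -
        2 / real (m n) * (real n / real (n + m n)) * ((real (n + m n))\<^sup>2 * (E x / (real (n + m n))\<^sup>2)) =
        (2 / real n + 2 / real (n + m n)) * E x" for x
        unfolding of_nat_add by (simp add: divide_simps) algebra
      then show ?case
        unfolding scaled_remainder_quadratic[of n m, OF elim m1] right_diff_distrib
        by (simp add: algebra_simps)
    qed
  qed auto
qed

section \<open>Convergence of the predictive loss\<close>

text \<open>A real right-hand side forces \<open>e\<close> and \<open>d\<close> to be real, so the
  defining relation of \<open>h_n\<close> can be solved for the relative entropy.\<close>

lemma ereal_expansion_solve:
  assumes "ereal c + e - d = ereal h" "d < \<infinity>"
  shows "d = ereal (c + real_of_ereal e - h)"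
  using assms by (cases e; cases d) auto

lemma (in model) d_X_expansion:
  assumes g: "g \<in> smooth_priors \<Theta> \<mu> f" and h: "h_expansion \<Theta> \<mu> f D r g"
    and n: "1 \<le> n" and \<theta>: "\<theta> \<in> \<Theta>"
  shows "d_X \<mu> f n \<theta> (prior_of \<Theta> g) = ereal (real CARD('p) / 2 * ln (real n / (2 * pi * exp 1)) +
    real_of_ereal (elog (ennreal (sqrt (det (fisher_info \<mu> f \<theta>))) / ennreal (g \<theta>))) -
    (D \<theta> g / (2 * real n) + r n \<theta> g))"
  using g h n \<theta> unfolding smooth_priors_def prior_class_inf_def h_expansion_def h_n_def
  by (intro ereal_expansion_solve) auto

lemma smooth_prior_continuous: "g \<in> smooth_priors \<Theta> \<mu> f \<Longrightarrow> continuous_on \<Theta> g"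
  unfolding smooth_priors_def twice_continuously_differentiable_on_def
  by (blast intro: continuous_at_imp_continuous_on has_derivative_continuous)

lemma (in model) scaled_loss_eq:
  assumes J: "jeffreys \<mu> f \<in> smooth_priors \<Theta> \<mu> f" "h_expansion \<Theta> \<mu> f D r (jeffreys \<mu> f)"
    and g: "g \<in> smooth_priors \<Theta> \<mu> f" "h_expansion \<Theta> \<mu> f D r g"
    and n: "1 \<le> n" "1 \<le> m n" and \<theta>: "\<theta> \<in> \<Theta>"
  shows "ereal (2 * real n * real (n + m n) / real (m n)) * L_YX \<Theta> \<mu> f n (m n) \<theta> g =
    ereal ((D \<theta> g - D \<theta> (jeffreys \<mu> f)) +
      (scaled_remainder m (\<lambda>n \<theta>. r n \<theta> g) n \<theta> - scaled_remainder m (\<lambda>n \<theta>. r n \<theta> (jeffreys \<mu> f)) n \<theta>))"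
proof -
  let ?c = "2 * real n * real (n + m n) / real (m n)"
  have nm: "1 \<le> n + m n" using n by simp
  note d = d_X_expansion[OF g n(1) \<theta>] d_X_expansion[OF g nm \<theta>]
    d_X_expansion[OF J n(1) \<theta>] d_X_expansion[OF J nm \<theta>]
  \<comment> \<open>In the double difference the \<open>ln\<close> term depends on the sample size
    but not on the prior, and the \<open>elog\<close> term on the prior but not on the sample size;
    both cancel. The expansions also supply the finiteness required by
    \<open>L_YX_eq\<close>.\<close>
  have L: "L_YX \<Theta> \<mu> f n (m n) \<theta> g = ereal
      (((D \<theta> g / (2 * real n) + r n \<theta> g) - (D \<theta> g / (2 * real (n + m n)) + r (n + m n) \<theta> g)) -
       ((D \<theta> (jeffreys \<mu> f) / (2 * real n) + r n \<theta> (jeffreys \<mu> f)) -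
        (D \<theta> (jeffreys \<mu> f) / (2 * real (n + m n)) + r (n + m n) \<theta> (jeffreys \<mu> f))))"
    by (subst L_YX_eq[OF smooth_prior_continuous[OF g(1)] smooth_prior_continuous[OF J(1)] \<theta>])
      (simp_all only: d, simp_all)
  have "real n \<noteq> 0" "real (m n) \<noteq> 0" "real (n + m n) \<noteq> 0" using n by auto
  then have main: "?c * (a / (2 * real n) - a / (2 * real (n + m n))) = a" for a
    unfolding of_nat_add by (simp add: divide_simps) algebra
  show ?thesis
    unfolding L times_ereal.simps
    using main[of "D \<theta> g"] main[of "D \<theta> (jeffreys \<mu> f)"]
    by (simp only: scaled_remainder_def right_diff_distrib distrib_left) simp
qed

lemma (in model) loss_convergenceI:
  assumes J: "jeffreys \<mu> f \<in> smooth_priors \<Theta> \<mu> f" "h_expansion \<Theta> \<mu> f D r (jeffreys \<mu> f)"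
    and g: "g \<in> smooth_priors \<Theta> \<mu> f" "h_expansion \<Theta> \<mu> f D r g"
    and m: "\<forall>n\<ge>1. 1 \<le> m n"
    and rem: "\<And>K h. compact K \<Longrightarrow> K \<subseteq> \<Theta> \<Longrightarrow> h \<in> {g, jeffreys \<mu> f} \<Longrightarrow>
      uniform_limit K (scaled_remainder m (\<lambda>n \<theta>. r n \<theta> h)) (\<lambda>_. 0) sequentially"
  shows "loss_convergence \<Theta> \<mu> f D g m"
  unfolding loss_convergence_def converges_on_compacts_def
proof (intro allI impI conjI; elim conjE)
  fix K assume K: "compact K" "K \<subseteq> \<Theta>"
  let ?R = "\<lambda>h. scaled_remainder m (\<lambda>n \<theta>. r n \<theta> h)"
  let ?F = "\<lambda>n \<theta>. ereal (2 * real n * real (n + m n) / real (m n)) * L_YX \<Theta> \<mu> f n (m n) \<theta> g"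
  \<comment> \<open>One eventual identity with a real expression gives both finiteness and the
    limit; it starts at \<open>n = 1\<close>, where the expansions and \<open>m n \<ge> 1\<close>
    become available.\<close>
  have ev: "\<forall>\<^sub>F n in sequentially. \<forall>\<theta>\<in>K.
      ?F n \<theta> = ereal ((D \<theta> g - D \<theta> (jeffreys \<mu> f)) + (?R g n \<theta> - ?R (jeffreys \<mu> f) n \<theta>))"
    using eventually_ge_at_top[of 1]
    by eventually_elim (use m K in \<open>blast intro: scaled_loss_eq[OF J g]\<close>)
  then show "\<forall>\<^sub>F n in sequentially. \<forall>\<theta>\<in>K. \<bar>?F n \<theta>\<bar> \<noteq> \<infinity>"
    by eventually_elim auto
  have "uniform_limit K (\<lambda>n \<theta>. (D \<theta> g - D \<theta> (jeffreys \<mu> f)) + (?R g n \<theta> - ?R (jeffreys \<mu> f) n \<theta>))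
      (\<lambda>\<theta>. (D \<theta> g - D \<theta> (jeffreys \<mu> f)) + (0 - 0)) sequentially"
    using K by (intro uniform_limit_add uniform_limit_minus uniform_limit_const rem) auto
  then show "uniform_limit K (\<lambda>n \<theta>. real_of_ereal (?F n \<theta>)) (\<lambda>\<theta>. D \<theta> g - D \<theta> (jeffreys \<mu> f)) sequentially"
  proof (rule uniform_limit_cong[THEN iffD1, rotated -1])
    show "\<forall>\<^sub>F n in sequentially. \<forall>\<theta>\<in>K.
      (D \<theta> g - D \<theta> (jeffreys \<mu> f)) + (?R g n \<theta> - ?R (jeffreys \<mu> f) n \<theta>) = real_of_ereal (?F n \<theta>)"
      using ev by eventually_elim auto
  qed auto
qed

theorem theorem4p1:
  fixes \<Theta> :: "(real ^ 'p) set"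
    and \<mu> :: "'x measure"
    and f :: "'x \<Rightarrow> real ^ 'p \<Rightarrow> real"
    and D :: "real ^ 'p \<Rightarrow> (real ^ 'p \<Rightarrow> real) \<Rightarrow> real"
    and r :: "nat \<Rightarrow> real ^ 'p \<Rightarrow> (real ^ 'p \<Rightarrow> real) \<Rightarrow> real"
    and \<pi> :: "real ^ 'p \<Rightarrow> real"
    and m :: "nat \<Rightarrow> nat"
  assumes model: "statistical_model \<Theta> \<mu> f"
    and jeffreys: "jeffreys \<mu> f \<in> smooth_priors \<Theta> \<mu> f"
    and prior: "\<pi> \<in> smooth_priors \<Theta> \<mu> f"
    and expansion: "h_expansion \<Theta> \<mu> f D r \<pi>" "h_expansion \<Theta> \<mu> f D r (jeffreys \<mu> f)"
    and m_pos: "\<forall>n\<ge>1. 1 \<le> m n"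
  shows "(R1 \<Theta> r \<pi> \<and> R1 \<Theta> r (jeffreys \<mu> f) \<longrightarrow>
            liminf (\<lambda>n. ereal (real (m n) / real n)) > 0 \<longrightarrow> loss_convergence \<Theta> \<mu> f D \<pi> m) \<and>
         (R2 \<Theta> r \<pi> \<and> R2 \<Theta> r (jeffreys \<mu> f) \<longrightarrow>
            filterlim m at_top sequentially \<longrightarrow> loss_convergence \<Theta> \<mu> f D \<pi> m) \<and>
         (R3 \<Theta> r \<pi> \<and> R3 \<Theta> r (jeffreys \<mu> f) \<longrightarrow> loss_convergence \<Theta> \<mu> f D \<pi> m)"
proof -
  interpret model \<Theta> \<mu> f by standard (rule model)
  note conv = loss_convergenceI[OF jeffreys expansion(2) prior expansion(1) m_pos]
  show ?thesis
  proof (intro conjI impI; elim conjE)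
    assume R: "R1 \<Theta> r \<pi>" "R1 \<Theta> r (jeffreys \<mu> f)"
      and lim: "liminf (\<lambda>n. ereal (real (m n) / real n)) > 0"
    show "loss_convergence \<Theta> \<mu> f D \<pi> m"
      by (rule conv, rule scaled_remainder_null_R1[OF m_pos lim]) (use R in \<open>auto simp: R1_def\<close>)
  next
    assume R: "R2 \<Theta> r \<pi>" "R2 \<Theta> r (jeffreys \<mu> f)" and lim: "filterlim m at_top sequentially"
    show "loss_convergence \<Theta> \<mu> f D \<pi> m"
    proof (rule conv)
      fix K h assume "compact K" "K \<subseteq> \<Theta>" "h \<in> {\<pi>, jeffreys \<mu> f}"
      then obtain b where "\<forall>\<^sub>F n in sequentially. \<forall>\<theta>\<in>K. \<bar>r n \<theta> h\<bar> \<le> b / (real n)\<^sup>2"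
        using R unfolding R2_def by blast
      then show "uniform_limit K (scaled_remainder m (\<lambda>n \<theta>. r n \<theta> h)) (\<lambda>_. 0) sequentially"
        by (rule scaled_remainder_null_R2[OF m_pos lim])
    qed
  next
    assume R: "R3 \<Theta> r \<pi>" "R3 \<Theta> r (jeffreys \<mu> f)"
    show "loss_convergence \<Theta> \<mu> f D \<pi> m"
    proof (rule conv)
      fix K h assume K: "compact K" "K \<subseteq> \<Theta>" and h: "h \<in> {\<pi>, jeffreys \<mu> f}"
      then obtain E where E: "continuous_on \<Theta> E"
        and lim: "uniform_limit K (\<lambda>n \<theta>. (real n)\<^sup>2 * (r n \<theta> h - E \<theta> / (real n)\<^sup>2)) (\<lambda>_. 0) sequentially"
        using R unfolding R3_def by blast
      \<comment> \<open>Continuity of \<open>E\<close> on the compact set gives the uniform bound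
        that the estimate needs.\<close>
      have "bounded (E ` K)"
        using K E by (intro compact_imp_bounded compact_continuous_image) (auto intro: continuous_on_subset)
      then obtain b where "\<forall>\<theta>\<in>K. \<bar>E \<theta>\<bar> \<le> b"
        by (auto simp: bounded_iff)
      then show "uniform_limit K (scaled_remainder m (\<lambda>n \<theta>. r n \<theta> h)) (\<lambda>_. 0) sequentially"
        using lim by (rule scaled_remainder_null_R3[OF m_pos])
    qed
  qed
qed

end
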